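(* Let $\langle\cdot,\cdot\rangle_{\mathsf s}$ be the discrete Sobolev inner product $$\langle f,g\rangle_{\mathsf s}=\int f(x)g(x)\,d\mu(x)+\sum_{j=1}^{N}\sum_{k=0}^{d_j}\lambda_{j,k}\,f^{(k)}(c_j)\,g^{(k)}(c_j)$$ with data as described in the context, and for $n\ge 0$ let $S_n$ be the associated monic orthogonal polynomial of degree $n$. If $\langle\cdot,\cdot\rangle_{\mathsf s}$ is sequentially ordered, then for every $n\ge 0$ the polynomial $S_n$ has at least $n-d^*$ changes of sign on $(a,b)$, where $d^*$ is the number of pairs $(j,k)$ with $\lambda_{j,k}>0$.
   Context: $\mu$ is a positive finite Borel measure on $\mathbb{R}$ with finite moments whose support $\operatorname{supp}\mu$ contains infinitely many points. $\mathbf{Co}(A)$ denotes the convex hull of a set $A\subset\mathbb{R}$ and $A^{\mathrm o}$ its interior; $(a,b)=\mathbf{Co}(\operatorname{supp}\mu)^{\mathrm o}$ (possibly unbounded). $N\ge 1$ and $d_1,\dots,d_N\ge 0$ are integers, $\lambda_{j,k}\ge 0$ are real numbers for $1\le j\le N$, $0\le k\le d_j$, and $c_1,\dots,c_N$ are pairwise distinct points of $\mathbb{R}\setminus(a,b)$. It is assumed (without loss of generality) that $\lambda_{j,d_j}>0$ for every $j$ and $d_1\le d_2\le\dots\le d_N$. (Set $\lambda_{j,k}=0$ for $k>d_j$.) $S_n$ is the unique monic polynomial of degree $n$ with $\langle x^k,S_n\rangle_{\mathsf s}=0$ for $k=0,1,\dots,n-1$. Sequentially ordered: put $\Delta_0=\mathbf{Co}\big(\operatorname{supp}\mu\cup\{c_j:\lambda_{j,0}>0\}\big)$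 and $\Delta_k=\mathbf{Co}\big(\{c_j:\lambda_{j,k}>0\}\big)$ for $1\le k\le d_N$ (the convex hull of the empty set is empty). The inner product is called sequentially ordered if $$\Delta_k\cap\Big(\mathbf{Co}\big(\textstyle\bigcup_{i=0}^{k-1}\Delta_i\big)\Big)^{\mathrm o}=\emptyset,\qquad k=1,2,\dots,d_N.$$ *)

theory Defs
  imports "HOL-Analysis.Analysis" "HOL-Computational_Algebra.Polynomial"
begin

definition measure_support :: "real measure \<Rightarrow> real set" where
  "measure_support M = {x. \<forall>U. open U \<and> x \<in> U \<longrightarrow> emeasure M U > 0}"

definition sobolev_inner ::
  "real measure \<Rightarrow> nat \<Rightarrow> (nat \<Rightarrow> nat) \<Rightarrow> (nat \<Rightarrow> real) \<Rightarrow> (nat \<Rightarrow> nat \<Rightarrow> real)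
     \<Rightarrow> real poly \<Rightarrow> real poly \<Rightarrow> real" where
  "sobolev_inner M N d c l f g =
     (LINT x|M. poly f x * poly g x)
     + (\<Sum>j=1..N. \<Sum>k=0..d j. l j k * poly ((pderiv ^^ k) f) (c j) * poly ((pderiv ^^ k) g) (c j))"

definition is_sobolev_mop ::
  "real measure \<Rightarrow> nat \<Rightarrow> (nat \<Rightarrow> nat) \<Rightarrow> (nat \<Rightarrow> real) \<Rightarrow> (nat \<Rightarrow> nat \<Rightarrow> real)
     \<Rightarrow> nat \<Rightarrow> real poly \<Rightarrow> bool" where
  "is_sobolev_mop M N d c l n S \<longleftrightarrow>
     degree S = n \<and> lead_coeff S = 1 \<and> (\<forall>k<n. sobolev_inner M N d c l (monom 1 k) S = 0)"

definition sobolev_mop ::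
  "real measure \<Rightarrow> nat \<Rightarrow> (nat \<Rightarrow> nat) \<Rightarrow> (nat \<Rightarrow> real) \<Rightarrow> (nat \<Rightarrow> nat \<Rightarrow> real)
     \<Rightarrow> nat \<Rightarrow> real poly" where
  "sobolev_mop M N d c l n = (THE S. is_sobolev_mop M N d c l n S)"

text \<open>Coefficients \<open>l j k\<close> with \<open>k > d j\<close> are read as zero: the guard \<open>k \<le> d j\<close> ignores
  whatever values the function \<open>l\<close> takes there.\<close>

definition active_points ::
  "nat \<Rightarrow> (nat \<Rightarrow> nat) \<Rightarrow> (nat \<Rightarrow> real) \<Rightarrow> (nat \<Rightarrow> nat \<Rightarrow> real) \<Rightarrow> nat \<Rightarrow> real set" where
  "active_points N d c l k = {c j | j. j \<in> {1..N} \<and> k \<le> d j \<and> l j k > 0}"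

definition sobolev_Delta ::
  "real measure \<Rightarrow> nat \<Rightarrow> (nat \<Rightarrow> nat) \<Rightarrow> (nat \<Rightarrow> real) \<Rightarrow> (nat \<Rightarrow> nat \<Rightarrow> real) \<Rightarrow> nat \<Rightarrow> real set" where
  "sobolev_Delta M N d c l k =
     (if k = 0 then convex hull (measure_support M \<union> active_points N d c l 0)
      else convex hull (active_points N d c l k))"

definition sequentially_ordered ::
  "real measure \<Rightarrow> nat \<Rightarrow> (nat \<Rightarrow> nat) \<Rightarrow> (nat \<Rightarrow> real) \<Rightarrow> (nat \<Rightarrow> nat \<Rightarrow> real) \<Rightarrow> bool" where
  "sequentially_ordered M N d c l \<longleftrightarrow>
     (\<forall>k\<in>{1..d N}. sobolev_Delta M N d c l k
         \<inter> interior (convex hull (\<Union>i<k. sobolev_Delta M N d c l i)) = {})"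

definition sign_change_at :: "(real \<Rightarrow> real) \<Rightarrow> real \<Rightarrow> bool" where
  "sign_change_at f x \<longleftrightarrow>
     (\<exists>e>0. \<forall>y\<in>{x - e<..<x}. \<forall>z\<in>{x<..<x + e}. f y * f z < 0)"

definition sign_changes_on :: "real set \<Rightarrow> (real \<Rightarrow> real) \<Rightarrow> nat" where
  "sign_changes_on I f = card {x \<in> I. sign_change_at f x}"

lemma finite_sign_changes:
  fixes p :: "real poly"
  assumes "p \<noteq> 0"
  shows "finite {x \<in> I. sign_change_at (poly p) x}"
proof (rule finite_subset)
  show "finite {x. poly p x = 0}" using assms by (rule poly_roots_finite)
  show "{x \<in> I. sign_change_at (poly p) x} \<subseteq> {x. poly p x = 0}"
  proof (clarify, rule ccontr)
    fix x assume "sign_change_at (poly p) x" and nz: "poly p x \<noteq> 0"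
    then obtain e where e: "e > 0"
      "\<And>y z. y \<in> {x - e<..<x} \<Longrightarrow> z \<in> {x<..<x + e} \<Longrightarrow> poly p y * poly p z < 0"
      unfolding sign_change_at_def by blast
    have "open {t. poly p t * poly p x > 0}"
      by (intro open_Collect_less continuous_intros)
    moreover have "x \<in> {t. poly p t * poly p x > 0}"
      using nz by (auto simp: zero_less_mult_iff)
    ultimately obtain r where r: "r > 0" "ball x r \<subseteq> {t. poly p t * poly p x > 0}"
      by (meson openE)
    define h where "h = min e r / 2"
    have h: "h > 0" "h < e" "h < r" using e(1) r(1) by (auto simp: h_def)
    have "x - h \<in> ball x r" "x + h \<in> ball x r" using h by (auto simp: dist_real_def)
    then have "poly p (x - h) * poly p x > 0" "poly p (x + h) * poly p x > 0" using r(2) by blast+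
    then have "poly p (x - h) * poly p (x + h) > 0"
      by (auto simp: zero_less_mult_iff)
    moreover have "poly p (x - h) * poly p (x + h) < 0" using h by (intro e(2)) auto
    ultimately show False by simp
  qed
qed

lemma higher_pderiv_add': "(pderiv ^^ k) (p + q) = (pderiv ^^ k) p + (pderiv ^^ k) (q :: real poly)"
  by (induction k) (simp_all add: pderiv_add)

lemma higher_pderiv_smult': "(pderiv ^^ k) (smult a p) = smult a ((pderiv ^^ k) (p :: real poly))"
  by (induction k) (simp_all add: pderiv_smult)

text \<open>Under the standing hypotheses the description in \<open>sobolev_mop\<close> is well posed.\<close>

context
  fixes M :: "real measure" and N :: nat and d :: "nat \<Rightarrow> nat"
    and c :: "nat \<Rightarrow> real" and l :: "nat \<Rightarrow> nat \<Rightarrow> real"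
  assumes sets_M: "sets M = sets borel"
    and moments: "\<And>k::nat. integrable M (\<lambda>x. x ^ k)"
    and inf_supp: "infinite (measure_support M)"
    and l_nonneg: "\<And>j k. j \<in> {1..N} \<Longrightarrow> k \<le> d j \<Longrightarrow> l j k \<ge> 0"
begin

abbreviation (input) "sip \<equiv> sobolev_inner M N d c l"

lemma integrable_poly_moments: "integrable M (\<lambda>x. poly p x)"
  unfolding poly_altdef by (intro Bochner_Integration.integrable_sum integrable_mult_right moments)

lemma integrable_poly_mult: "integrable M (\<lambda>x. poly p x * poly q x)"
  using integrable_poly_moments[of "p * q"] by simp

lemma sip_commute: "sip f g = sip g f"
  unfolding sobolev_inner_def by (simp add: mult_ac)

lemma sip_add_left: "sip (f + g) h = sip f h + sip g h"
  unfolding sobolev_inner_def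
  by (simp add: higher_pderiv_add' distrib_right distrib_left sum.distrib integrable_poly_mult)

lemma sip_smult_left: "sip (smult a f) h = a * sip f h"
  unfolding sobolev_inner_def
  by (simp add: higher_pderiv_smult' distrib_left sum_distrib_left mult_ac)

lemma sip_diff_left: "sip (f - g) h = sip f h - sip g h"
  using sip_add_left[of f "smult (-1) g" h] sip_smult_left[of "-1" g h] by simp

lemma sip_diff_right: "sip h (f - g) = sip h f - sip h g"
  using sip_diff_left[of f g h] by (simp only: sip_commute[of h])

lemma sip_add_right: "sip h (f + g) = sip h f + sip h g"
  using sip_add_left[of f g h] by (simp only: sip_commute[of h])

lemma sip_smult_right: "sip h (smult a f) = a * sip h f"
  using sip_smult_left[of a f h] by (simp only: sip_commute[of h])

lemma sip_pos:
  assumes "p \<noteq> 0"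
  shows "sip p p > 0"
proof -
  have nn: "0 \<le> (\<Sum>j=1..N. \<Sum>k=0..d j. l j k * poly ((pderiv ^^ k) p) (c j) * poly ((pderiv ^^ k) p) (c j))"
    using l_nonneg by (intro sum_nonneg) (auto simp: mult.assoc intro!: mult_nonneg_nonneg zero_le_square)
  have "(LINT x|M. poly p x * poly p x) \<noteq> 0"
  proof
    assume "(LINT x|M. poly p x * poly p x) = 0"
    then have ae: "AE x in M. poly p x * poly p x = 0"
      using integral_nonneg_eq_0_iff_AE[OF integrable_poly_mult[of p p]] by simp
    have "finite {x. poly p x = 0}" using assms by (rule poly_roots_finite)
    then have "\<not> measure_support M \<subseteq> {x. poly p x = 0}"
      using inf_supp finite_subset by blast
    then obtain x where x: "x \<in> measure_support M" "poly p x \<noteq> 0" by blast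
    have op: "open {y. poly p y \<noteq> 0}"
      by (intro open_Collect_neq continuous_intros)
    then have "emeasure M {y. poly p y \<noteq> 0} > 0"
      using x unfolding measure_support_def by blast
    moreover have "AE y in M. y \<notin> {y. poly p y \<noteq> 0}" using ae by auto
    moreover have "{y. poly p y \<noteq> 0} \<in> sets M" using op sets_M by simp
    ultimately show False
      using AE_iff_measurable[of "{y. poly p y \<noteq> 0}" M "\<lambda>y. y \<notin> {y. poly p y \<noteq> 0}"]
        sets_eq_imp_space_eq[OF sets_M] by auto
  qed
  moreover have "(LINT x|M. poly p x * poly p x) \<ge> 0" by (rule Bochner_Integration.integral_nonneg) simp
  ultimately show ?thesis using nn unfolding sobolev_inner_def by linarith
qed

lemma sip_lower_zero:
  assumes "\<And>k. k < n \<Longrightarrow> sip (monom 1 k) g = 0" and "\<And>i. i \<ge> n \<Longrightarrow> coeff r i = 0"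
  shows "sip r g = 0"
  using assms
proof (induction n arbitrary: r)
  case 0
  then have "r = 0" by (intro poly_eqI) simp
  then show ?case using sip_smult_left[of 0 0 g] by simp
next
  case (Suc n)
  let ?m = "smult (coeff r n) (monom 1 n)"
  have "sip (r - ?m) g = 0"
  proof (rule Suc.IH)
    show "sip (monom 1 k) g = 0" if "k < n" for k using Suc.prems(1) that by simp
    show "coeff (r - ?m) i = 0" if "i \<ge> n" for i
      using Suc.prems(2)[of i] that by (cases "i = n") auto
  qed
  then show ?case using Suc.prems(1)[of n] by (simp add: sip_diff_left sip_smult_left)
qed

lemma sip_projection:
  "\<exists>q. (\<forall>i\<ge>n. coeff q i = 0) \<and> (\<forall>k<n. sip (monom 1 k) (p - q) = 0)"
proof (induction n arbitrary: p)
  case 0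
  show ?case by (intro exI[of _ 0]) simp
next
  case (Suc n)
  obtain q0 where q0: "\<forall>i\<ge>n. coeff q0 i = 0" "\<forall>k<n. sip (monom 1 k) (p - q0) = 0"
    using Suc.IH by blast
  obtain r where r: "\<forall>i\<ge>n. coeff r i = 0" "\<forall>k<n. sip (monom 1 k) (monom 1 n - r) = 0"
    using Suc.IH by blast
  define s where "s = monom 1 n - r"
  have "coeff s n = 1" using r by (simp add: s_def)
  then have "s \<noteq> 0" by auto
  moreover have "sip r s = 0" using sip_lower_zero[of n s r] r by (simp add: s_def)
  ultimately have pos: "sip (monom 1 n) s > 0"
    using sip_pos[of s] sip_diff_left[of "monom 1 n" r s] by (simp add: s_def)
  define a where "a = sip (monom 1 n) (p - q0) / sip (monom 1 n) s"
  have "sip (monom 1 k) (p - (q0 + smult a s)) = 0" if "k < Suc n" for k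
  proof -
    have "sip (monom 1 k) (p - (q0 + smult a s)) = sip (monom 1 k) (p - q0) - a * sip (monom 1 k) s"
      by (simp add: sip_diff_right sip_add_right sip_smult_right)
    also have "\<dots> = 0"
      using that q0(2) r(2) pos by (cases "k = n") (auto simp: s_def a_def)
    finally show ?thesis .
  qed
  moreover have "\<forall>i\<ge>Suc n. coeff (q0 + smult a s) i = 0"
    using q0(1) r(1) by (auto simp: s_def)
  ultimately show ?case by blast
qed

lemma ex1_sobolev_mop: "\<exists>!S. is_sobolev_mop M N d c l n S"
proof (rule ex_ex1I)
  obtain q where q: "\<forall>i\<ge>n. coeff q i = 0" "\<forall>k<n. sip (monom 1 k) (monom 1 n - q) = 0"
    using sip_projection by blast
  let ?s = "monom 1 n - q"
  have "coeff ?s n = 1" using q by simp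
  moreover have "degree ?s \<le> n" using q by (intro degree_le) auto
  ultimately have "degree ?s = n" by (metis le_antisym le_degree zero_neq_one)
  then show "\<exists>S. is_sobolev_mop M N d c l n S"
    using q \<open>coeff ?s n = 1\<close> unfolding is_sobolev_mop_def by metis
next
  fix S T assume S: "is_sobolev_mop M N d c l n S" and T: "is_sobolev_mop M N d c l n T"
  have "coeff (S - T) i = 0" if "i \<ge> n" for i
    using S T that unfolding is_sobolev_mop_def by (cases "i = n") (auto simp: coeff_eq_0)
  moreover have "sip (monom 1 k) (S - T) = 0" if "k < n" for k
    using S T that by (simp add: is_sobolev_mop_def sip_diff_right)
  ultimately have "sip (S - T) (S - T) = 0" by (metis sip_lower_zero)
  then have "S - T = 0" using sip_pos[of "S - T"] by (metis less_irrefl)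
  then show "S = T" by simp
qed

lemma sobolev_mop_is_mop: "is_sobolev_mop M N d c l n (sobolev_mop M N d c l n)"
  unfolding sobolev_mop_def by (rule theI') (rule ex1_sobolev_mop)

end

end

theory Submission
  imports Defs
begin

text \<open>Let \<open>X\<close> be the set of sign changes of \<open>S\<^sub>n\<close> in \<open>(a, b)\<close> and suppose that
  \<open>card X + d\<^sup>* < n\<close>. There is a nonzero polynomial \<open>Q\<close> of degree at most \<open>card X + d\<^sup>*\<close> that
  vanishes on \<open>X\<close> and has \<open>Q\<^sup>(\<^sup>k\<^sup>)(c\<^sub>j) = 0\<close> for every active pair \<open>(j, k)\<close>. Because of the sequential
  ordering, the zeros that Rolle's theorem yields in the interior of a convex hull are always distinct
  from the next prescribed ones; counting them shows that, for a suitable degree, \<open>Q\<close> has simple zeros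
  at \<open>X\<close> and no other zero in \<open>(a, b)\<close>. Then \<open>Q S\<^sub>n\<close> has constant sign on the support of \<open>\<mu>\<close>,
  whereas orthogonality forces its integral to vanish.\<close>

lemma poly_rolle_set:
  fixes p :: "real poly"
  assumes "finite Z" and "\<And>z. z \<in> Z \<Longrightarrow> poly p z = 0"
  shows "\<exists>W. finite W \<and> (\<forall>w\<in>W. poly (pderiv p) w = 0) \<and> card Z \<le> Suc (card W) \<and> W \<inter> Z = {}
           \<and> (\<forall>w\<in>W. \<exists>x\<in>Z. \<exists>y\<in>Z. x < w \<and> w < y)"
  using assms
proof (induction Z rule: finite_linorder_max_induct)
  case empty
  show ?case by (intro exI[of _ "{}"]) simp
next
  case (insert b Z)
  then obtain W where W: "finite W" "\<forall>w\<in>W. poly (pderiv p) w = 0" "card Z \<le> Suc (card W)"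
    "W \<inter> Z = {}" "\<forall>w\<in>W. \<exists>x\<in>Z. \<exists>y\<in>Z. x < w \<and> w < y"
    by auto
  show ?case
  proof (cases "Z = {}")
    case True
    then show ?thesis by (intro exI[of _ "{}"]) simp
  next
    case False
    define a where "a = Max Z"
    have a: "a \<in> Z" "\<And>z. z \<in> Z \<Longrightarrow> z \<le> a" "a < b"
      using insert.hyps False by (auto simp: a_def)
    obtain v where v: "a < v" "v < b" "poly (pderiv p) v = 0"
      using poly_MVT[OF a(3), of p] insert.prems a by auto
    have lt: "w < a" if "w \<in> W" for w using W(5) a(2) that by (meson less_le_trans)
    have "v \<notin> W" using lt[of v] v(1) by auto
    then have "card (insert b Z) \<le> Suc (card (insert v W))"
      using insert.hyps W by (simp add: card_insert_if)
    moreover have "insert v W \<inter> insert b Z = {}" using lt v a W(4) by force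
    moreover have "\<forall>w\<in>insert v W. \<exists>x\<in>insert b Z. \<exists>y\<in>insert b Z. x < w \<and> w < y"
      using W(5) v a by blast
    moreover have "finite (insert v W)" "\<forall>w\<in>insert v W. poly (pderiv p) w = 0"
      using W(1,2) v(3) by simp_all
    ultimately show ?thesis by (intro exI[of _ "insert v W"] conjI)
  qed
qed

lemma between_in_interior_convex:
  fixes C :: "real set"
  assumes "convex C" "x \<in> C" "y \<in> C" "x < w" "w < y"
  shows "w \<in> interior C"
proof (rule interiorI)
  show "open {x<..<y}" "w \<in> {x<..<y}" using assms by auto
  have "{x..y} \<subseteq> C"
    using assms by (metis closed_segment_eq_real_ivl1 closed_segment_subset less_trans less_imp_le)
  then show "{x<..<y} \<subseteq> C" by auto
qed

lemma higher_pderiv_rolle: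
  fixes p :: "real poly"
  assumes conv: "\<And>k. convex (C k)" and sub: "\<And>k. A k \<subseteq> C k" and mono: "\<And>k. C k \<subseteq> C (Suc k)"
    and disj: "\<And>k. A (Suc k) \<inter> interior (C k) = {}" and finA: "\<And>k. finite (A k)"
    and zeros: "\<And>k x. x \<in> A k \<Longrightarrow> poly ((pderiv ^^ k) p) x = 0"
    and Z: "finite Z" "Z \<subseteq> C m" "\<And>z. z \<in> Z \<Longrightarrow> poly ((pderiv ^^ m) p) z = 0"
    and "m \<le> n"
  shows "\<exists>W. finite W \<and> W \<subseteq> C n \<and> (\<forall>w\<in>W. poly ((pderiv ^^ n) p) w = 0)
           \<and> card Z + (\<Sum>i\<in>{m<..n}. card (A i)) \<le> card W + (n - m)"
  using \<open>m \<le> n\<close>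
proof (induction n rule: dec_induct)
  case base
  show ?case using Z by (intro exI[of _ Z]) auto
next
  case (step n)
  then obtain W where W: "finite W" "W \<subseteq> C n" "\<forall>w\<in>W. poly ((pderiv ^^ n) p) w = 0"
    "card Z + (\<Sum>i\<in>{m<..n}. card (A i)) \<le> card W + (n - m)" by blast
  obtain V where V: "finite V" "\<forall>w\<in>V. poly (pderiv ((pderiv ^^ n) p)) w = 0"
    "card W \<le> Suc (card V)" "\<forall>w\<in>V. \<exists>x\<in>W. \<exists>y\<in>W. x < w \<and> w < y"
    using poly_rolle_set[OF W(1), of "(pderiv ^^ n) p"] W(3) by blast
  have Vi: "V \<subseteq> interior (C n)"
    using V(4) W(2) between_in_interior_convex[OF conv] by blast
  then have "V \<inter> A (Suc n) = {}" using disj by blast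
  then have c: "card (V \<union> A (Suc n)) = card V + card (A (Suc n))"
    using V(1) finA by (simp add: card_Un_disjoint)
  have "(\<Sum>i\<in>{m<..Suc n}. card (A i)) = card (A (Suc n)) + (\<Sum>i\<in>{m<..n}. card (A i))"
    using step.hyps by (simp add: sum.nat_ivl_Suc' flip: atLeastSucAtMost_greaterThanAtMost)
  then have "card Z + (\<Sum>i\<in>{m<..Suc n}. card (A i)) \<le> card (V \<union> A (Suc n)) + (Suc n - m)"
    using W(4) V(3) c step by linarith
  moreover have "V \<union> A (Suc n) \<subseteq> C (Suc n)"
    using Vi interior_subset mono sub by blast
  moreover have "finite (V \<union> A (Suc n))" using V(1) finA by simp
  moreover have "\<forall>w\<in>V \<union> A (Suc n). poly ((pderiv ^^ Suc n) p) w = 0"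
    using V(2) zeros[of _ "Suc n"] unfolding funpow.simps comp_def by blast
  ultimately show ?case by (intro exI[of _ "V \<union> A (Suc n)"] conjI)
qed

lemma degree_add_smult_less:
  fixes p q :: "real poly"
  assumes "p \<noteq> 0" and "a \<noteq> 0 \<Longrightarrow> degree q < degree p"
  shows "degree (p + smult a q) = degree p \<and> p + smult a q \<noteq> 0"
proof (cases "a = 0")
  case False
  then have "degree (smult a q) < degree p" using assms(2) by simp
  then have "degree (p + smult a q) = degree p" by (rule degree_add_eq_left)
  then show ?thesis using \<open>degree (smult a q) < degree p\<close> by force
qed (simp add: assms(1))

text \<open>Gaussian elimination: distinct degrees serve as a certificate of linear independence that
  survives the elimination of one functional \<open>f\<close> with a pivot \<open>b\<^sub>0\<close> of least degree.\<close>

lemma eliminate_functional: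
  fixes f :: "real poly \<Rightarrow> real"
  assumes f_add: "\<And>p q. f (p + q) = f p + f q" and f_smult: "\<And>a p. f (smult a p) = a * f p"
    and V: "\<And>p q. p \<in> V \<Longrightarrow> q \<in> V \<Longrightarrow> p + q \<in> V" "\<And>a p. p \<in> V \<Longrightarrow> smult a p \<in> V"
    and B: "finite B" "B \<subseteq> V" "inj_on degree B" "0 \<notin> B"
  shows "\<exists>D \<subseteq> {p \<in> V. f p = 0}. finite D \<and> inj_on degree D \<and> 0 \<notin> D \<and> card B \<le> Suc (card D)"
proof (cases "\<exists>b. b \<in> B \<and> f b \<noteq> 0")
  case False
  then show ?thesis using B by (intro exI[of _ B]) auto
next
  case True
  then obtain b where "b \<in> B \<and> f b \<noteq> 0" by blast
  from ex_has_least_nat[of "\<lambda>b. b \<in> B \<and> f b \<noteq> 0", OF this, of degree]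
  obtain b\<^sub>0 where b0: "b\<^sub>0 \<in> B \<and> f b\<^sub>0 \<noteq> 0"
    and least: "\<forall>b. b \<in> B \<and> f b \<noteq> 0 \<longrightarrow> degree b\<^sub>0 \<le> degree b"
    by blast
  define h where "h b = b + smult (- (f b / f b\<^sub>0)) b\<^sub>0" for b
  have h_deg: "degree (h b) = degree b \<and> h b \<noteq> 0" if "b \<in> B - {b\<^sub>0}" for b
    unfolding h_def
  proof (rule degree_add_smult_less)
    show "b \<noteq> 0" using that B(4) by blast
    assume "- (f b / f b\<^sub>0) \<noteq> 0"
    then have "degree b\<^sub>0 \<le> degree b" "degree b\<^sub>0 \<noteq> degree b"
      using that b0 least B(3) by (auto dest: inj_onD)
    then show "degree b\<^sub>0 < degree b" by simp
  qed
  let ?D = "h ` (B - {b\<^sub>0})"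
  have inj: "inj_on (degree \<circ> h) (B - {b\<^sub>0})"
    using inj_on_diff[OF B(3)] h_deg by (simp add: inj_on_def)
  have card: "card ?D = card B - 1"
    using b0 by (simp add: card_image[OF inj_on_imageI2[OF inj]])
  show ?thesis
  proof (intro exI[of _ ?D] conjI)
    show "?D \<subseteq> {p \<in> V. f p = 0}"
    proof (rule image_subsetI)
      fix b assume "b \<in> B - {b\<^sub>0}"
      then have "h b \<in> V" unfolding h_def using b0 B(2) by (intro V) auto
      moreover have "f (h b) = 0" unfolding h_def f_add f_smult using b0 by simp
      ultimately show "h b \<in> {p \<in> V. f p = 0}" by simp
    qed
    show "0 \<notin> ?D" using h_deg by force
  qed (use B(1) card inj_on_imageI[OF inj] in auto)
qed

lemma exists_common_kernel_subspace:
  fixes F :: "(real poly \<Rightarrow> real) set"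
  assumes "finite F"
    and "\<And>f p q. f \<in> F \<Longrightarrow> f (p + q) = f p + f q"
    and "\<And>f a p. f \<in> F \<Longrightarrow> f (smult a p) = a * f p"
    and "\<And>p q. p \<in> V \<Longrightarrow> q \<in> V \<Longrightarrow> p + q \<in> V" and "\<And>a p. p \<in> V \<Longrightarrow> smult a p \<in> V"
    and "finite B" "B \<subseteq> V" "inj_on degree B" "0 \<notin> B" "card F < card B"
  shows "\<exists>p\<in>V. p \<noteq> 0 \<and> (\<forall>f\<in>F. f p = 0)"
  using assms
proof (induction F arbitrary: B V rule: finite_induct)
  case empty
  then obtain b where "b \<in> B" by fastforce
  then show ?case using empty by (metis empty_iff subsetD)
next
  case (insert f F)
  show ?case
  proof -
    let ?K = "{p \<in> V. f p = 0}"
    have f: "f (p + q) = f p + f q" "f (smult a p) = a * f p" for p q a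
      using insert.prems(1,2) by simp_all
    have "\<exists>D \<subseteq> ?K. finite D \<and> inj_on degree D \<and> 0 \<notin> D \<and> card B \<le> Suc (card D)"
      using f insert.prems(3-8) by (rule eliminate_functional)
    then obtain D where D: "D \<subseteq> ?K" "finite D" "inj_on degree D" "0 \<notin> D" "card B \<le> Suc (card D)"
      by blast
    have "card F < card D" using D(5) insert.hyps insert.prems(9) by simp
    have "\<exists>p\<in>?K. p \<noteq> 0 \<and> (\<forall>f\<in>F. f p = 0)"
    proof (rule insert.IH[OF insert.prems(1,2)])
      show "p + q \<in> ?K" if "p \<in> ?K" "q \<in> ?K" for p q using that insert.prems(3) by (simp add: f)
      show "smult a p \<in> ?K" if "p \<in> ?K" for a p using that insert.prems(4) by (simp add: f)
    qed (rule D \<open>card F < card D\<close> insertI2 | assumption)+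
    then show ?thesis by auto
  qed
qed

lemma exists_poly_common_kernel:
  fixes F :: "(real poly \<Rightarrow> real) set"
  assumes "finite F" and "card F \<le> t"
    and "\<And>f p q. f \<in> F \<Longrightarrow> f (p + q) = f p + f q"
    and "\<And>f a p. f \<in> F \<Longrightarrow> f (smult a p) = a * f p"
  shows "\<exists>p. p \<noteq> 0 \<and> degree p \<le> t \<and> (\<forall>f\<in>F. f p = 0)"
proof -
  let ?B = "monom (1::real) ` {..t}"
  have inj: "inj_on (monom (1::real)) {..t}" by (rule inj_onI) (metis degree_monom_eq one_neq_zero)
  let ?V = "{p :: real poly. degree p \<le> t}"
  have V: "p \<in> ?V \<Longrightarrow> q \<in> ?V \<Longrightarrow> p + q \<in> ?V" "p \<in> ?V \<Longrightarrow> smult a p \<in> ?V" for p q a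
    by (auto intro: degree_add_le order_trans[OF degree_smult_le])
  have B: "finite ?B" "?B \<subseteq> ?V" "inj_on degree ?B" "0 \<notin> ?B"
    by (auto simp: degree_monom_eq monom_eq_0_iff inj_on_def)
  have "card F < card ?B" using assms(2) by (simp add: card_image[OF inj])
  then show ?thesis using exists_common_kernel_subspace[OF assms(1,3,4) V B] by auto
qed

lemma higher_pderiv_eq_0_iff:
  fixes p :: "real poly"
  assumes "p \<noteq> 0"
  shows "(pderiv ^^ k) p = 0 \<longleftrightarrow> degree p < k"
proof -
  have deg: "degree ((pderiv ^^ k) p) = degree p - k" for k
    by (induction k) (auto simp: degree_pderiv)
  have "(pderiv ^^ k) p \<noteq> 0" if "k \<le> degree p" for k
  proof (cases k)
    case (Suc j)
    then have "degree ((pderiv ^^ j) p) \<noteq> 0" using that deg[of j] by simp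
    then show ?thesis by (simp add: Suc pderiv_eq_0_iff)
  qed (use assms in simp)
  moreover have "(pderiv ^^ k) p = 0" if lt: "degree p < k"
  proof -
    obtain j where "k = Suc (degree p + j)" using less_imp_Suc_add[OF lt] by blast
    then show ?thesis using deg[of "degree p + j"] by (simp add: pderiv_eq_0_iff)
  qed
  ultimately show ?thesis by (meson not_le)
qed

lemma rolle_degree_bound:
  fixes p :: "real poly"
  assumes "p \<noteq> 0"
    and conv: "\<And>k. convex (C k)" and sub: "\<And>k. A k \<subseteq> C k" and mono: "\<And>k. C k \<subseteq> C (Suc k)"
    and disj: "\<And>k. A (Suc k) \<inter> interior (C k) = {}" and finA: "\<And>k. finite (A k)"
    and zeros: "\<And>k x. x \<in> A k \<Longrightarrow> poly ((pderiv ^^ k) p) x = 0"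
    and Z: "finite Z" "Z \<subseteq> C m" "\<And>z. z \<in> Z \<Longrightarrow> poly ((pderiv ^^ m) p) z = 0"
    and "m \<le> degree p"
  shows "card Z + (\<Sum>i\<in>{m<..degree p}. card (A i)) \<le> degree p - m"
proof -
  let ?q = "(pderiv ^^ degree p) p"
  obtain W where W: "\<forall>w\<in>W. poly ?q w = 0"
    "card Z + (\<Sum>i\<in>{m<..degree p}. card (A i)) \<le> card W + (degree p - m)"
    using higher_pderiv_rolle[OF conv sub mono disj finA zeros Z \<open>m \<le> degree p\<close>] by auto
  have nz: "?q \<noteq> 0" using \<open>p \<noteq> 0\<close> by (simp add: higher_pderiv_eq_0_iff)
  moreover have "pderiv ?q = 0"
    using higher_pderiv_eq_0_iff[OF \<open>p \<noteq> 0\<close>, of "Suc (degree p)"] by simp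
  ultimately have "poly ?q w \<noteq> 0" for w by (auto simp: pderiv_eq_0_iff elim!: degree_eq_zeroE)
  then have "W = {}" using W(1) by blast
  then show ?thesis using W(2) by simp
qed

text \<open>The degree \<open>t\<close> is the least one for which the number of conditions on derivatives of order
  at most \<open>t\<close> does not exceed \<open>t\<close>. Conditions of higher order then hold automatically,
  and the Rolle count leaves no room for a further zero, not even for a double one.\<close>

lemma sequentially_ordered_interpolation:
  fixes A C :: "nat \<Rightarrow> real set"
  assumes conv: "\<And>k. convex (C k)" and sub: "\<And>k. A k \<subseteq> C k" and mono: "\<And>k. C k \<subseteq> C (Suc k)"
    and disj: "\<And>k. A (Suc k) \<inter> interior (C k) = {}" and finA: "\<And>k. finite (A k)"
    and bound: "\<And>k. (\<Sum>i\<le>k. card (A i)) \<le> e"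
    and X: "finite X" "X \<subseteq> interior (C 0)" "X \<inter> A 0 = {}"
  shows "\<exists>Q. Q \<noteq> 0 \<and> degree Q \<le> card X + e \<and> (\<forall>k. \<forall>x\<in>A k. poly ((pderiv ^^ k) Q) x = 0)
           \<and> (\<forall>x\<in>X. order x Q = 1) \<and> (\<forall>x\<in>C 0. poly Q x = 0 \<longrightarrow> x \<in> X \<union> A 0)"
proof -
  define \<rho> where "\<rho> k = card X + (\<Sum>i\<le>k. card (A i))" for k
  define t where "t = (LEAST k. \<rho> k \<le> k)"
  have ex: "\<rho> (card X + e) \<le> card X + e" using bound by (simp add: \<rho>_def)
  have t: "\<rho> t \<le> t" "t \<le> card X + e" "\<And>k. \<rho> k \<le> k \<Longrightarrow> t \<le> k"
    using LeastI[of "\<lambda>k. \<rho> k \<le> k", OF ex] Least_le[of "\<lambda>k. \<rho> k \<le> k"] ex by (auto simp: t_def)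
  define D where "D = (\<lambda>(k, x) p. poly ((pderiv ^^ k) p) x :: real)"
  define I where "I = (Pair 0 ` X) \<union> (SIGMA k:{..t}. A k)"
  have "card I \<le> card (Pair (0::nat) ` X) + card (SIGMA k:{..t}. A k)"
    unfolding I_def by (rule card_Un_le)
  also have "\<dots> = \<rho> t" using finA by (simp add: \<rho>_def card_image inj_on_def)
  finally have "card I \<le> t" using t(1) by simp
  moreover have finI: "finite I" using X finA by (auto simp: I_def)
  ultimately have cF: "card (D ` I) \<le> t" using card_image_le[OF finI, of D] by simp
  have "f (p + q) = f p + f q" "f (smult a p) = a * f p" if "f \<in> D ` I" for f p q a
    using that by (auto simp: D_def higher_pderiv_add' higher_pderiv_smult')
  then obtain Q where Q: "Q \<noteq> 0" "degree Q \<le> t" "\<And>i. i \<in> I \<Longrightarrow> D i Q = 0"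
    using exists_poly_common_kernel[OF finite_imageI[OF finI] cF] by auto
  have QX: "poly Q x = 0" if "x \<in> X" for x using Q(3)[of "(0, x)"] that by (auto simp: I_def D_def)
  have QA: "poly ((pderiv ^^ k) Q) x = 0" if "x \<in> A k" for k x
  proof (cases "k \<le> t")
    case True
    then show ?thesis using Q(3)[of "(k, x)"] that by (auto simp: I_def D_def)
  next
    case False
    then have "degree Q < k" using Q(2) by simp
    then have "(pderiv ^^ k) Q = 0" by (rule higher_pderiv_eq_0_iff[THEN iffD2, OF Q(1)])
    then show ?thesis by simp
  qed
  note rolle = rolle_degree_bound[where A = A and C = C and p = Q, OF Q(1) conv sub mono disj finA QA]
  have X0: "finite (X \<union> A 0)" "X \<union> A 0 \<subseteq> C 0" "card (X \<union> A 0) = card X + card (A 0)"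
    using X finA sub interior_subset[of "C 0"] by (auto simp: card_Un_disjoint)
  have \<rho>: "\<rho> k = card (X \<union> A 0) + (\<Sum>i\<in>{0<..k}. card (A i))" for k
  proof -
    have "(\<Sum>i\<le>k. card (A i)) = card (A 0) + (\<Sum>i\<in>{0<..k}. card (A i))"
      unfolding atMost_atLeast0 by (rule sum.head) simp
    then show ?thesis using X0(3) by (simp add: \<rho>_def)
  qed
  have Q0: "poly ((pderiv ^^ 0) Q) x = 0" if "x \<in> X \<union> A 0" for x using QX QA[of x 0] that by auto
  have "\<rho> (degree Q) \<le> degree Q"
    using rolle[of "X \<union> A 0" 0, OF _ X0(1,2) Q0 le0] unfolding \<rho> diff_zero by blast
  then have deg: "degree Q = t" using t(3) Q(2) by (simp add: order_antisym)
  have "t \<le> \<rho> t"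
  proof (cases t)
    case (Suc s)
    then have "\<not> \<rho> s \<le> s" using t(3)[of s] by auto
    moreover have "\<rho> s \<le> \<rho> t" using Suc by (simp add: \<rho>_def)
    ultimately show ?thesis using Suc by simp
  qed simp
  then have \<rho>t: "\<rho> t = t" using t(1) by simp
  have "x \<in> X \<union> A 0" if x: "x \<in> C 0" "poly Q x = 0" for x
  proof (rule ccontr)
    assume "x \<notin> X \<union> A 0"
    then have "card (insert x (X \<union> A 0)) = Suc (card (X \<union> A 0))" using X0 by simp
    moreover have "card (insert x (X \<union> A 0)) + (\<Sum>i\<in>{0<..degree Q}. card (A i)) \<le> degree Q - 0"
    proof (rule rolle)
      show "poly ((pderiv ^^ 0) Q) z = 0" if "z \<in> insert x (X \<union> A 0)" for z
        using that x Q0 by auto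
    qed (use X0 x in auto)
    ultimately show False using \<rho>[of t] \<rho>t deg by simp
  qed
  moreover have "order x Q = 1" if x: "x \<in> X" for x
  proof -
    have "poly (pderiv Q) x \<noteq> 0"
    proof
      assume dx: "poly (pderiv Q) x = 0"
      obtain W where W: "finite W" "\<forall>w\<in>W. poly (pderiv Q) w = 0"
        "card (X \<union> A 0) \<le> Suc (card W)" "W \<inter> (X \<union> A 0) = {}"
        "\<forall>w\<in>W. \<exists>y\<in>X \<union> A 0. \<exists>z\<in>X \<union> A 0. y < w \<and> w < z"
        using poly_rolle_set[OF X0(1), of Q] Q0 unfolding funpow_0 by blast
      let ?Z = "insert x W \<union> A 1"
      have "w \<in> interior (C 0)" if "w \<in> W" for w
      proof -
        obtain y z where "y \<in> X \<union> A 0" "z \<in> X \<union> A 0" "y < w" "w < z"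
          using W(5) \<open>w \<in> W\<close> by blast
        then show ?thesis using X0(2) by (intro between_in_interior_convex[OF conv]) auto
      qed
      then have Wi: "insert x W \<subseteq> interior (C 0)" using X(2) x by auto
      then have "insert x W \<inter> A 1 = {}" using disj[of 0] by auto
      moreover have "x \<notin> W" using W(4) x by blast
      ultimately have cZ: "card ?Z = Suc (card W) + card (A 1)"
        using W(1) finA by (subst card_Un_disjoint) auto
      have tpos: "1 \<le> t"
        using \<rho>[of t] \<rho>t X0(1) x by (metis One_nat_def Suc_leI UnCI add_gr_0 card_gt_0_iff empty_iff)
      have "card ?Z + (\<Sum>i\<in>{1<..degree Q}. card (A i)) \<le> degree Q - 1"
      proof (rule rolle)
        show "?Z \<subseteq> C 1" using Wi interior_subset[of "C 0"] mono[of 0] sub[of 1] by auto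
        show "finite ?Z" using W finA by simp
        show "poly ((pderiv ^^ 1) Q) z = 0" if "z \<in> ?Z" for z using that W dx QA[of z 1] by auto
        show "1 \<le> degree Q" using tpos deg by simp
      qed
      moreover have "{0<..t} = insert 1 {1<..t}" using tpos by auto
      then have "(\<Sum>i\<in>{0<..t}. card (A i)) = card (A 1) + (\<Sum>i\<in>{1<..t}. card (A i))" by simp
      ultimately show False using \<rho>[of t] \<rho>t cZ W(3) tpos unfolding deg by linarith
    qed
    then have "order x (pderiv Q) = 0" by (simp add: order_0I)
    moreover have "pderiv Q \<noteq> 0" using \<open>poly (pderiv Q) x \<noteq> 0\<close> by auto
    moreover have "order x Q \<noteq> 0" using QX[OF x] Q(1) by (metis order_root)
    ultimately show ?thesis using order_pderiv[of Q x] QX[OF x] Q(1) by simp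
  qed
  moreover have "degree Q \<le> card X + e" using Q(2) t(2) by (rule order_trans)
  ultimately show ?thesis using Q(1) QA by blast
qed

lemma sign_change_at_iff_odd_order:
  fixes p :: "real poly"
  assumes "p \<noteq> 0"
  shows "sign_change_at (poly p) x \<longleftrightarrow> odd (order x p)"
proof -
  define k where "k = order x p"
  obtain g where g: "p = [:-x, 1:] ^ k * g" "\<not> [:-x, 1:] dvd g"
    using order_decomp[OF assms, of x] by (auto simp: k_def)
  have gx: "poly g x \<noteq> 0" using g(2) by (simp add: poly_eq_0_iff_dvd)
  have pe: "poly p y = (y - x) ^ k * poly g y" for y by (simp add: g(1) algebra_simps)
  have "open {t. poly g t * poly g x > 0}" by (intro open_Collect_less continuous_intros)
  moreover have "x \<in> {t. poly g t * poly g x > 0}" using gx by (auto simp: zero_less_mult_iff)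
  ultimately obtain r where r: "r > 0" "ball x r \<subseteq> {t. poly g t * poly g x > 0}" by (meson openE)
  have gpos: "poly g y * poly g z > 0" if "\<bar>y - x\<bar> < r" "\<bar>z - x\<bar> < r" for y z
  proof -
    have "y \<in> ball x r" "z \<in> ball x r" using that by (auto simp: dist_real_def)
    then have "poly g y * poly g x > 0" "poly g z * poly g x > 0" using r(2) by blast+
    then show ?thesis by (auto simp: zero_less_mult_iff)
  qed
  have eq: "poly p y * poly p z = ((y - x) * (z - x)) ^ k * (poly g y * poly g z)" for y z
    by (simp add: pe power_mult_distrib mult_ac)
  show ?thesis
  proof
    assume "sign_change_at (poly p) x"
    then obtain e where e: "e > 0"
      "\<And>y z. y \<in> {x - e<..<x} \<Longrightarrow> z \<in> {x<..<x + e} \<Longrightarrow> poly p y * poly p z < 0"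
      unfolding sign_change_at_def by blast
    define h where "h = min e r / 2"
    have h: "h > 0" "h < e" "h < r" using e(1) r(1) by (auto simp: h_def)
    have "poly p (x - h) * poly p (x + h) < 0" using h by (intro e(2)) auto
    then have "((- h) * h) ^ k * (poly g (x - h) * poly g (x + h)) < 0" by (simp add: eq)
    moreover have "poly g (x - h) * poly g (x + h) > 0" using h by (intro gpos) auto
    ultimately have "((- h) * h) ^ k < 0"
      by (meson less_imp_le mult_nonneg_nonneg not_less)
    then show "odd (order x p)" by (metis k_def power_less_zero_eq)
  next
    assume odd: "odd (order x p)"
    show "sign_change_at (poly p) x"
      unfolding sign_change_at_def
    proof (intro exI[of _ r] conjI ballI)
      fix y z assume y: "y \<in> {x - r<..<x}" and z: "z \<in> {x<..<x + r}"
      have "(y - x) * (z - x) < 0" using y z by (simp add: mult_neg_pos)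
      then have "((y - x) * (z - x)) ^ k < 0" using odd by (simp add: k_def power_less_zero_eq)
      moreover have "poly g y * poly g z > 0" using y z by (intro gpos) auto
      ultimately show "poly p y * poly p z < 0" by (simp add: eq mult_neg_pos)
    qed (use r in simp)
  qed
qed

lemma poly_even_orders_same_sign:
  fixes p :: "real poly"
  assumes "p \<noteq> 0" and "is_interval I" and "\<And>x. x \<in> I \<Longrightarrow> even (order x p)"
    and "x \<in> I" "y \<in> I"
  shows "poly p x * poly p y \<ge> 0"
  using assms(1,3)
proof (induction "degree p" arbitrary: p rule: less_induct)
  case less
  show ?case
  proof (cases "\<exists>r\<in>I. poly p r = 0")
    case True
    then obtain r where r: "r \<in> I" "poly p r = 0" by blast
    define k where "k = order r p"
    obtain g where g: "p = [:-r, 1:] ^ k * g" "\<not> [:-r, 1:] dvd g"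
      using order_decomp[OF less.prems(1), of r] by (auto simp: k_def)
    have k: "k > 0" "even k" using less.prems r by (auto simp: k_def order_root)
    have "g \<noteq> 0" using g by auto
    then have "degree p = k + degree g"
      using g(1) by (simp add: degree_mult_eq degree_linear_power)
    moreover have "even (order z g)" if "z \<in> I" for z
    proof -
      have "order z p = order z ([:-r, 1:] ^ k) + order z g"
        using g(1) less.prems(1) by (metis order_mult)
      moreover have "even (order z ([:-r, 1:] ^ k))"
      proof (cases "z = r")
        case True
        then show ?thesis using k by (simp add: order_power_n_n)
      next
        case False
        then have "poly ([:-r, 1:] ^ k) z \<noteq> 0" by simp
        then show ?thesis by (simp add: order_0I)
      qed
      ultimately show ?thesis using less.prems(2)[OF that] by simp
    qed
    ultimately have "poly g x * poly g y \<ge> 0" using less.hyps[of g] k \<open>g \<noteq> 0\<close> by simp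
    moreover have "poly p x * poly p y = (x - r) ^ k * (y - r) ^ k * (poly g x * poly g y)"
      by (simp add: g(1) algebra_simps)
    ultimately show ?thesis using k by (simp add: zero_le_even_power)
  next
    case False
    have "\<not> poly p a * poly p b < 0" if ab: "a < b" "a \<in> I" "b \<in> I" for a b
    proof
      assume neg: "poly p a * poly p b < 0"
      then obtain w where w: "a < w" "w < b" "poly p w = 0" using poly_IVT[OF ab(1) neg] by blast
      then have "w \<in> I" using ab assms(2) by (meson is_interval_1 less_imp_le)
      then show False using w False by blast
    qed
    then show ?thesis using assms(4,5)
      by (metis linorder_neqE_linordered_idom mult.commute not_less zero_le_square)
  qed
qed

lemma emeasure_Compl_measure_support:
  assumes "sets M = sets borel"
  shows "closed (measure_support M)" and "emeasure M (- measure_support M) = 0"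
proof -
  define \<U> where "\<U> = {U :: real set. open U \<and> emeasure M U = 0}"
  have eq: "- measure_support M = \<Union>\<U>"
    by (simp add: measure_support_def \<U>_def zero_less_iff_neq_zero set_eq_iff) blast
  have "open (\<Union>\<U>)" by (auto simp: \<U>_def)
  then show "closed (measure_support M)" using eq by (simp add: closed_def)
  obtain \<V> where \<V>: "\<V> \<subseteq> \<U>" "countable \<V>" "\<Union>\<V> = \<Union>\<U>"
    using Lindelof[of \<U>] by (auto simp: \<U>_def)
  have "(\<Union>V\<in>\<V>. V) \<in> null_sets M"
  proof (rule null_sets_UN')
    show "V \<in> null_sets M" if "V \<in> \<V>" for V
      using that \<V>(1) assms by (auto simp: \<U>_def null_sets_def)
  qed (rule \<V>(2))
  then show "emeasure M (- measure_support M) = 0" using eq \<V>(3) by (simp add: null_sets_def)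
qed

lemma AE_measure_support:
  assumes "sets M = sets borel"
  shows "AE x in M. x \<in> measure_support M"
proof (rule AE_I)
  show "{x \<in> space M. x \<notin> measure_support M} \<subseteq> - measure_support M" by auto
  show "- measure_support M \<in> sets M"
    using emeasure_Compl_measure_support(1)[OF assms] assms by auto
qed (rule emeasure_Compl_measure_support(2)[OF assms])

lemma integral_poly_neq_0:
  fixes p :: "real poly"
  assumes "sets M = sets borel" and "\<And>k::nat. integrable M (\<lambda>x. x ^ k)"
    and "infinite (measure_support M)" and "p \<noteq> 0"
    and nonneg: "\<And>x. x \<in> measure_support M \<Longrightarrow> poly p x \<ge> 0"
  shows "(LINT x|M. poly p x) \<noteq> 0"
proof
  assume 0: "(LINT x|M. poly p x) = 0"
  have int: "integrable M (poly p)"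
    unfolding poly_altdef by (intro Bochner_Integration.integrable_sum integrable_mult_right assms(2))
  have "AE x in M. 0 \<le> poly p x" using AE_measure_support[OF assms(1)] nonneg by auto
  then have ae: "AE x in M. poly p x = 0" using integral_nonneg_eq_0_iff_AE[OF int] 0 by simp
  have "\<not> measure_support M \<subseteq> {x. poly p x = 0}"
    using poly_roots_finite[OF assms(4)] assms(3) finite_subset by blast
  then obtain x where x: "x \<in> measure_support M" "poly p x \<noteq> 0" by blast
  have op: "open {y. poly p y \<noteq> 0}" by (intro open_Collect_neq continuous_intros)
  then have "emeasure M {y. poly p y \<noteq> 0} > 0" using x unfolding measure_support_def by blast
  moreover have "{y. poly p y \<noteq> 0} \<in> sets M" using op assms(1) by simp
  ultimately show False
    using ae AE_iff_measurable[of "{y. poly p y \<noteq> 0}" M "\<lambda>y. poly p y = 0"]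
      sets_eq_imp_space_eq[OF assms(1)] by auto
qed

lemma convex_hull_subset_closure_interior:
  fixes S :: "real set"
  assumes "infinite S"
  shows "S \<subseteq> closure (interior (convex hull S))"
proof -
  obtain x y where "x \<in> S" "y \<in> S" "x < y"
    using assms by (metis finite.simps infinite_imp_nonempty insertI1 linorder_neqE subsetI subset_singletonD ex_in_conv insert_iff)
  then have "(x + y) / 2 \<in> interior (convex hull S)"
    by (intro between_in_interior_convex[OF convex_convex_hull, of x S y]) (auto simp: hull_inc)
  then have "closure (interior (convex hull S)) = closure (convex hull S)"
    by (intro convex_closure_interior) auto
  then show ?thesis using hull_subset[of S convex] closure_subset[of "convex hull S"] by simp
qed

theorem theorem1:
  fixes M :: "real measure" and N :: nat and d :: "nat \<Rightarrow> nat"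
    and c :: "nat \<Rightarrow> real" and l :: "nat \<Rightarrow> nat \<Rightarrow> real"
  assumes "sets M = sets borel" and "finite_measure M"
    and "\<And>k::nat. integrable M (\<lambda>x. x ^ k)"
    and "infinite (measure_support M)"
    and "N \<ge> 1"
    and "\<And>j k. j \<in> {1..N} \<Longrightarrow> k \<le> d j \<Longrightarrow> l j k \<ge> 0"
    and "\<And>j. j \<in> {1..N} \<Longrightarrow> l j (d j) > 0"
    and "\<And>i j. 1 \<le> i \<Longrightarrow> i \<le> j \<Longrightarrow> j \<le> N \<Longrightarrow> d i \<le> d j"
    and "inj_on c {1..N}"
    and "\<And>j. j \<in> {1..N} \<Longrightarrow> c j \<notin> interior (convex hull (measure_support M))"
    and "sequentially_ordered M N d c l"
  shows "\<forall>n. int (sign_changes_on (interior (convex hull (measure_support M)))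
                     (poly (sobolev_mop M N d c l n)))
           \<ge> int n - int (card {(j, k). j \<in> {1..N} \<and> k \<le> d j \<and> l j k > 0})"
proof (intro allI)
  fix n
  show "int (sign_changes_on (interior (convex hull (measure_support M)))
               (poly (sobolev_mop M N d c l n)))
      \<ge> int n - int (card {(j, k). j \<in> {1..N} \<and> k \<le> d j \<and> l j k > 0})"
  proof -
    let ?supp = "measure_support M"
    let ?J = "interior (convex hull ?supp)"
    define A where "A = active_points N d c l"
    define C where "C k = convex hull (\<Union>i<Suc k. sobolev_Delta M N d c l i)" for k
    define S where "S = sobolev_mop M N d c l n"
    define P where "P = {(j, k). j \<in> {1..N} \<and> k \<le> d j \<and> l j k > 0}"
    have finP: "finite P"
      by (rule finite_subset[of _ "SIGMA j:{1..N}. {..d j}"]) (auto simp: P_def)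
    have "is_sobolev_mop M N d c l n S"
      unfolding S_def using assms(1,3,4,6) by (rule sobolev_mop_is_mop)
    then have S: "degree S = n" "S \<noteq> 0" "\<And>k. k < n \<Longrightarrow> sobolev_inner M N d c l (monom 1 k) S = 0"
      by (auto simp: is_sobolev_mop_def)
    define X where "X = {x \<in> ?J. sign_change_at (poly S) x}"
    have finX: "finite X" unfolding X_def using S(2) by (rule finite_sign_changes)
    have A_img: "A k = c ` {j. (j, k) \<in> P}" for k
      by (auto simp: A_def active_points_def P_def)
    have finj: "finite {j. (j, k) \<in> P}" for k
      by (rule finite_subset[of _ "{1..N}"]) (auto simp: P_def)
    have finA: "finite (A k)" for k using finj by (simp add: A_img)
    have cardA: "card (A k) = card {j. (j, k) \<in> P}" for k
      unfolding A_img by (rule card_image, rule inj_on_subset[OF assms(9)]) (auto simp: P_def)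
    have bound: "(\<Sum>i\<le>k. card (A i)) \<le> card P" for k
    proof -
      have "(\<Sum>i\<le>k. card (A i)) = card (SIGMA i:{..k}. {j. (j, i) \<in> P})" using finj by (simp add: cardA)
      also have "\<dots> = card (prod.swap ` (SIGMA i:{..k}. {j. (j, i) \<in> P}))"
        by (simp add: card_image)
      also have "\<dots> \<le> card P" using finP by (intro card_mono) auto
      finally show ?thesis .
    qed
    have AD: "A k \<subseteq> sobolev_Delta M N d c l k" for k
      by (auto simp: A_def sobolev_Delta_def hull_inc)
    have DC: "sobolev_Delta M N d c l k \<subseteq> C k" for k
      unfolding C_def by (rule order_trans[OF _ hull_subset]) blast
    have J_C: "?J \<subseteq> interior (C 0)"
    proof (intro interior_mono)
      have "?supp \<subseteq> sobolev_Delta M N d c l 0" by (auto simp: sobolev_Delta_def hull_inc)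
      then show "convex hull ?supp \<subseteq> C 0" using DC[of 0] by (simp add: C_def hull_minimal)
    qed
    have J_A: "?J \<inter> A k = {}" for k using assms(10) by (auto simp: A_def active_points_def)
    have "\<exists>Q. Q \<noteq> 0 \<and> degree Q \<le> card X + card P \<and> (\<forall>k. \<forall>x\<in>A k. poly ((pderiv ^^ k) Q) x = 0)
            \<and> (\<forall>x\<in>X. order x Q = 1) \<and> (\<forall>x\<in>C 0. poly Q x = 0 \<longrightarrow> x \<in> X \<union> A 0)"
    proof (rule sequentially_ordered_interpolation)
      show "convex (C k)" for k by (simp add: C_def)
      show "A k \<subseteq> C k" for k using AD DC by blast
      show "C k \<subseteq> C (Suc k)" for k unfolding C_def by (intro hull_mono UN_mono) auto
      show "A (Suc k) \<inter> interior (C k) = {}" for k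
      proof (cases "Suc k \<le> d N")
        case True
        then have "sobolev_Delta M N d c l (Suc k) \<inter> interior (C k) = {}"
          using assms(11) by (auto simp: sequentially_ordered_def C_def)
        then show ?thesis using AD by blast
      next
        case False
        have "d j \<le> d N" if "j \<in> {1..N}" for j using assms(8)[of j N] that by auto
        then have "A (Suc k) = {}" using False by (force simp: A_def active_points_def)
        then show ?thesis by simp
      qed
      show "X \<subseteq> interior (C 0)" using J_C by (auto simp: X_def)
      show "X \<inter> A 0 = {}" using J_A[of 0] by (auto simp: X_def)
    qed (use finA bound finX in auto)
    then obtain Q where Q: "Q \<noteq> 0" "degree Q \<le> card X + card P"
      "\<And>k x. x \<in> A k \<Longrightarrow> poly ((pderiv ^^ k) Q) x = 0"
      "\<And>x. x \<in> X \<Longrightarrow> order x Q = 1" "\<And>x. x \<in> C 0 \<Longrightarrow> poly Q x = 0 \<Longrightarrow> x \<in> X \<union> A 0"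
      by blast
    have "n \<le> card X + card P"
    proof (rule ccontr)
      assume "\<not> n \<le> card X + card P"
      then have "coeff Q i = 0" if "i \<ge> n" for i using Q(2) that by (intro coeff_eq_0) simp
      then have "sobolev_inner M N d c l Q S = 0"
        using sip_lower_zero[where N = N and d = d and c = c and l = l, OF assms(1,3,4,6)] S(3) by blast
      moreover have "l j k * poly ((pderiv ^^ k) Q) (c j) * poly ((pderiv ^^ k) S) (c j) = 0"
        if "j \<in> {1..N}" "k \<in> {0..d j}" for j k
      proof (cases "l j k = 0")
        case False
        then have "c j \<in> A k" using assms(6)[of j k] that by (force simp: A_def active_points_def)
        then show ?thesis using Q(3) by simp
      qed simp
      ultimately have int0: "(LINT x|M. poly (Q * S) x) = 0"
        by (simp add: sobolev_inner_def)
      have QS: "Q * S \<noteq> 0" using Q(1) S(2) by simp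
      have X_iff: "x \<in> X \<longleftrightarrow> odd (order x S)" if "x \<in> ?J" for x
        using sign_change_at_iff_odd_order[OF S(2)] that by (simp add: X_def)
      have ev: "even (order x (Q * S))" if x: "x \<in> ?J" for x
      proof (cases "x \<in> X")
        case True
        then have "odd (order x S)" using X_iff x by simp
        then show ?thesis using Q(4)[OF True] QS by (simp add: order_mult)
      next
        case False
        then have "even (order x S)" using X_iff x by simp
        moreover have "x \<in> C 0" "x \<notin> A 0" using x J_C interior_subset J_A by blast+
        then have "order x Q = 0" using Q(5)[of x] False by (auto intro: order_0I)
        ultimately show ?thesis using QS by (simp add: order_mult)
      qed
      have same: "poly (Q * S) x * poly (Q * S) y \<ge> 0" if "x \<in> ?J" "y \<in> ?J" for x y
        using QS _ ev that
        by (rule poly_even_orders_same_sign) (simp add: is_interval_convex_1 convex_interior)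
      have "\<exists>a. a \<noteq> 0 \<and> (\<forall>x\<in>?J. 0 \<le> poly (smult a (Q * S)) x)"
      proof (cases "\<exists>y\<in>?J. poly (Q * S) y \<noteq> 0")
        case True
        then obtain y where "y \<in> ?J" "poly (Q * S) y \<noteq> 0" by blast
        then show ?thesis using same by (intro exI[of _ "poly (Q * S) y"]) (simp only: poly_smult, blast)
      next
        case False
        then show ?thesis by (intro exI[of _ 1]) auto
      qed
      then obtain a where a: "a \<noteq> 0" "\<And>x. x \<in> ?J \<Longrightarrow> 0 \<le> poly (smult a (Q * S)) x" by blast
      have "(LINT x|M. poly (smult a (Q * S)) x) \<noteq> 0"
      proof (rule integral_poly_neq_0[OF assms(1,3,4)])
        show "smult a (Q * S) \<noteq> 0" using a QS by simp
        fix x assume "x \<in> ?supp"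
        then have "x \<in> closure ?J" using convex_hull_subset_closure_interior[OF assms(4)] by blast
        moreover have "closure ?J \<subseteq> {x. 0 \<le> poly (smult a (Q * S)) x}"
          using a(2) by (intro closure_minimal closed_Collect_le continuous_intros) auto
        ultimately show "0 \<le> poly (smult a (Q * S)) x" by blast
      qed
      moreover have "(LINT x|M. poly (smult a (Q * S)) x) = a * (LINT x|M. poly (Q * S) x)"
        by (simp only: poly_smult) simp
      ultimately show False using int0 by simp
    qed
    then show ?thesis
      unfolding sign_changes_on_def S_def[symmetric] X_def[symmetric] P_def[symmetric] by linarith
  qed
qed

end
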